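(* Let $P=(G,R)$ be a partial field, $n\in\mathbb{N}$, $N=2^n-1$. For an arbitrary point $p=(p_J)_{J\subseteq[n]}\in\mathbf{P}^N(P)$ the following are equivalent: \begin{enumerate} \item There exist a skew-symmetric $n\times n$ matrix $A$ with entries in $P$ and a subset $T\subseteq[n]$ such that (for a suitable representative of $p$) $p_J=\mathrm{Pf}(A_{J\Delta T})$ for all $J\subseteq[n]$. \item $p$ is a strong orthogonal matroid over $P$. \item $p$ is a weak orthogonal matroid over $P$. \end{enumerate}
   Context: A partial field $P=(G,R)$ consists of a commutative ring $R$ with $1$ and a subgroup $G$ of its unit group containing $-1$; elements of $P$ are those of $G\cup\{0\}$; $\mathbf{P}^N(P)$ is the set of nonzero vectors $(p_J)_{J\subseteq[n]}$ with entries in $G\cup\{0\}$ modulo scaling by $G$; all equations are interpreted in $R$. $\Delta$ denotes symmetric difference. For $J\subseteq[n]$, $A_J$ is the principal submatrix with rows and columns $J$ (increasing order). Pfaffian: empty matrix has $\mathrm{Pf}=1$; odd size gives $0$; $\mathrm{Pf}\begin{pmatrix}0&a\\-a&0\end{pmatrix}=a$; for even size $m\ge4$, $\mathrm{Pf}(A)=\sum_{j=2}^m(-1)^j\mathrm{Pf}(A_{\{1,j\}})\mathrm{Pf}(A_{\{2,\dots,m\}\setminus\{j\}})$. Wick equations: $\sum_{j=1}^{k}(-1)^jX_{J_1\Delta\{i_j\}}X_{J_2\Delta\{i_j\}}=0$ for all $J_1,J_2\subseteq[n]$ with $J_1\Delta J_2=\{i_1<\dots<i_k\}$; the $4$-term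 Wick equations are those with $k=4$. A strong orthogonal matroid over $P$ is a point of $\mathbf{P}^N(P)$ satisfying all Wick equations; a weak orthogonal matroid over $P$ is a point of $\mathbf{P}^N(P)$ satisfying the $4$-term Wick equations whose support $\{J: p_J\ne0\}$ is the set of bases of an orthogonal matroid. An orthogonal matroid on $E$ is a nonempty collection $\mathcal{B}$ of subsets of $E$ such that for all $B_1,B_2\in\mathcal{B}$ and $x_1\in B_1\Delta B_2$ there is $x_2\in B_1\Delta B_2$, $x_2\ne x_1$, with $B_1\Delta\{x_1,x_2\}\in\mathcal{B}$. *)

theory Defs
  imports "Jordan_Normal_Form.DL_Submatrix" "HOL-Library.FuncSet"
begin

text \<open>
  The ground set is taken to be \<open>{..<n}\<close> instead of \<open>{1, \<dots>, n}\<close>, since rows and columns of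
  the library's matrices are numbered from 0. This order-preserving relabelling does not change
  any sign, because signs only involve positions within an ordered set.
\<close>

locale partial_field =
  fixes G :: "'a::comm_ring_1 set"
  assumes units: "\<And>x. x \<in> G \<Longrightarrow> x dvd 1"
    and one_mem: "1 \<in> G"
    and mult_closed: "\<And>x y. x \<in> G \<Longrightarrow> y \<in> G \<Longrightarrow> x * y \<in> G"
    and inverse_closed: "\<And>x y. x \<in> G \<Longrightarrow> x * y = 1 \<Longrightarrow> y \<in> G"
    and uminus_one_mem: "- 1 \<in> G"

definition pf_elements :: "'a::comm_ring_1 set \<Rightarrow> 'a set" where
  "pf_elements G = G \<union> {0}"

definition pf_vectors :: "'a::comm_ring_1 set \<Rightarrow> nat \<Rightarrow> (nat set \<Rightarrow> 'a) set" where
  "pf_vectors G n =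
     {v \<in> Pow {..<n} \<rightarrow>\<^sub>E pf_elements G. \<exists>J\<in>Pow {..<n}. v J \<noteq> 0}"

definition scaling_rel ::
    "'a::comm_ring_1 set \<Rightarrow> nat \<Rightarrow> ((nat set \<Rightarrow> 'a) \<times> (nat set \<Rightarrow> 'a)) set" where
  "scaling_rel G n =
     {(v, w). v \<in> pf_vectors G n \<and> w \<in> pf_vectors G n \<and>
              (\<exists>g\<in>G. \<forall>J\<in>Pow {..<n}. w J = g * v J)}"

text \<open>A point is a scaling class, so its members are exactly its representatives.\<close>

definition proj_space :: "'a::comm_ring_1 set \<Rightarrow> nat \<Rightarrow> (nat set \<Rightarrow> 'a) set set" where
  "proj_space G n = pf_vectors G n // scaling_rel G n"

text \<open>
  The zero diagonal is part of skew-symmetry; it does not follow from \<open>a\<^sub>i\<^sub>j = - a\<^sub>j\<^sub>i\<close> when 2 is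
  a zero divisor.
\<close>

definition skew_symmetric_mat :: "'a::comm_ring_1 mat \<Rightarrow> bool" where
  "skew_symmetric_mat A \<longleftrightarrow>
     square_mat A \<and> transpose_mat A = - A \<and> (\<forall>i<dim_row A. A $$ (i, i) = 0)"

abbreviation principal_submatrix :: "'a mat \<Rightarrow> nat set \<Rightarrow> 'a mat" where
  "principal_submatrix A J \<equiv> submatrix A J J"

text \<open>
  Expansion along the first row. The column with index \<open>j\<close> is the column at position \<open>j + 1\<close>, which
  carries the sign \<open>(-1)^(j + 1)\<close>.
\<close>

function pfaffian :: "'a::comm_ring_1 mat \<Rightarrow> 'a" where
  "pfaffian A =
     (if dim_row A = 0 then 1
      else if odd (dim_row A) then 0
      else if dim_row A = 2 then A $$ (0, 1)
      else (\<Sum>j\<in>{1..<dim_row A}. (- 1) ^ (j + 1)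
              * pfaffian (principal_submatrix A {0, j})
              * pfaffian (principal_submatrix A ({1..<dim_row A} - {j}))))"
  by pat_completeness auto
termination
proof (relation "measure dim_row", goal_cases)
  case 1
  then show ?case by simp
next
  case (2 A j)
  have "{i. i < dim_row A \<and> i \<in> {0, j}} = {0, j}" using 2 by auto
  then show ?case using 2 by (auto simp: dim_submatrix elim!: oddE evenE)
next
  case (3 A j)
  have "{i. i < dim_row A \<and> i \<in> {1..<dim_row A} - {j}} = {1..<dim_row A} - {j}" by auto
  then show ?case using 3 by (simp add: dim_submatrix)
qed

declare pfaffian.simps [simp del]

text \<open>
  For \<open>J1 \<Delta> J2 = {i\<^sub>1 < \<dots> < i\<^sub>k}\<close> the exponent of \<open>- 1\<close> at \<open>i = i\<^sub>j\<close> is the position \<open>j\<close>.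
\<close>

definition wick_equation :: "(nat set \<Rightarrow> 'a::comm_ring_1) \<Rightarrow> nat set \<Rightarrow> nat set \<Rightarrow> bool" where
  "wick_equation v J1 J2 \<longleftrightarrow>
     (\<Sum>i\<in>sym_diff J1 J2. (- 1) ^ card {l \<in> sym_diff J1 J2. l \<le> i}
        * v (sym_diff J1 {i}) * v (sym_diff J2 {i})) = 0"

definition orthogonal_matroid :: "'b set \<Rightarrow> 'b set set \<Rightarrow> bool" where
  "orthogonal_matroid E \<B> \<longleftrightarrow>
     \<B> \<subseteq> Pow E \<and> \<B> \<noteq> {} \<and>
     (\<forall>B1\<in>\<B>. \<forall>B2\<in>\<B>. \<forall>x1\<in>sym_diff B1 B2.
        \<exists>x2\<in>sym_diff B1 B2. x2 \<noteq> x1 \<and> sym_diff B1 {x1, x2} \<in> \<B>)"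

text \<open>
  The Wick equations are homogeneous and \<open>G\<close> consists of units, so the conditions below hold for
  all representatives of a point as soon as they hold for one.
\<close>

definition strong_orthogonal_matroid ::
    "'a::comm_ring_1 set \<Rightarrow> nat \<Rightarrow> (nat set \<Rightarrow> 'a) set \<Rightarrow> bool" where
  "strong_orthogonal_matroid G n p \<longleftrightarrow>
     p \<in> proj_space G n \<and>
     (\<forall>v\<in>p. \<forall>J1\<in>Pow {..<n}. \<forall>J2\<in>Pow {..<n}. wick_equation v J1 J2)"

definition weak_orthogonal_matroid ::
    "'a::comm_ring_1 set \<Rightarrow> nat \<Rightarrow> (nat set \<Rightarrow> 'a) set \<Rightarrow> bool" where
  "weak_orthogonal_matroid G n p \<longleftrightarrow>
     p \<in> proj_space G n \<and>
     (\<forall>v\<in>p. (\<forall>J1\<in>Pow {..<n}. \<forall>J2\<in>Pow {..<n}.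
                card (sym_diff J1 J2) = 4 \<longrightarrow> wick_equation v J1 J2) \<and>
             orthogonal_matroid {..<n} {J \<in> Pow {..<n}. v J \<noteq> 0})"

end

theory Submission
  imports Defs
begin

text \<open>
  The symmetric difference of \<open>J1\<close> and \<open>J2\<close> does not change when both are twisted by \<open>T\<close>, so the
  Wick equations are invariant under twisting and one may take \<open>T = {}\<close>.

  Pfaffians satisfy all Wick equations: for \<open>U = J1\<close> and \<open>V = J2\<close>, expand each \<open>Pf (x, V)\<close> with
  \<open>x \<in> U\<close> along the row of \<open>x\<close>; it vanishes for \<open>x \<in> V\<close> and is \<open>\<plusminus> Pf (V \<union> {x})\<close> otherwise.
  Given all Wick equations, the term of \<open>x1\<close> in one of them is a unit when \<open>B1\<close> and \<open>B2\<close> are bases,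
  so a second term is nonzero, which is the exchange axiom. Finally, let \<open>p\<close> be weak with
  \<open>p {} = 1\<close>, and let \<open>A\<close> have the entries \<open>p {i, j}\<close> for \<open>i < j\<close>. By induction on the size of
  \<open>J\<close>, either some basis \<open>K \<subseteq> J\<close> misses exactly four elements of \<open>J\<close>, and a 4-term Wick equation
  determines \<open>p J\<close> from smaller sets because \<open>p K\<close> is a unit; or exchange with the basis \<open>{}\<close>
  shows that \<open>p J\<close> and all terms in the expansion of \<open>Pf (A\<^sub>J)\<close> vanish.
\<close>

section \<open>Signs given by positions in an ordered set\<close>

text \<open>The strict count also makes sense for \<open>x\<close> outside \<open>V\<close>, where
  it is the place at which \<open>x\<close> would be inserted. Both kinds of \<open>x\<close> occur
  in the expansions below.\<close>

definition pos_sign :: "'i::linorder set \<Rightarrow> 'i \<Rightarrow> 'a::comm_ring_1" where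
  "pos_sign V x = (- 1) ^ card {l \<in> V. l < x}"

lemma pos_sign_square [simp]: "pos_sign V x * pos_sign V x = (1::'a::comm_ring_1)"
  by (simp add: pos_sign_def flip: power_add)

lemma pos_sign_square_left [simp]: "pos_sign V x * (pos_sign V x * z) = (z::'a::comm_ring_1)"
  by (metis mult.assoc mult_1 pos_sign_square)

lemma pos_sign_least:
  assumes "\<forall>y\<in>V. x \<le> y"
  shows "pos_sign V x = 1"
proof -
  have "{l \<in> V. l < x} = {}" using assms by (auto simp: not_less)
  then show ?thesis by (simp only: pos_sign_def card.empty power_0)
qed

lemma pos_sign_insert:
  assumes "finite V" "x \<notin> V"
  shows "pos_sign (insert x V) y = (if x < y then - pos_sign V y else pos_sign V y :: 'a::comm_ring_1)"
proof (cases "x < y")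
  case True
  then have "{l \<in> insert x V. l < y} = insert x {l \<in> V. l < y}" by auto
  then show ?thesis using True assms by (simp add: pos_sign_def)
next
  case False
  then have "{l \<in> insert x V. l < y} = {l \<in> V. l < y}" by auto
  then show ?thesis using False by (simp add: pos_sign_def)
qed

lemma pos_sign_remove:
  assumes "finite V" "x \<in> V"
  shows "pos_sign (V - {x}) y = (if x < y then - pos_sign V y else pos_sign V y :: 'a::comm_ring_1)"
  using pos_sign_insert[of "V - {x}" x y, where ?'a = 'a] assms by (simp add: insert_absorb)

text \<open>Elements of the intersection are counted twice on the right and cancel modulo 2. This
  splits the sign of a Wick term into one factor for each of the two sets.\<close>

lemma pos_sign_sym_diff:
  assumes "finite U" "finite V"
  shows "pos_sign (sym_diff U V) x = pos_sign U x * (pos_sign V x :: 'a::comm_ring_1)"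
proof -
  let ?c = "\<lambda>S. card {l \<in> S. l < x}"
  have "{l \<in> sym_diff U V. l < x} = {l \<in> U - V. l < x} \<union> {l \<in> V - U. l < x}" by auto
  moreover have "{l \<in> U. l < x} = {l \<in> U - V. l < x} \<union> {l \<in> U \<inter> V. l < x}" by auto
  moreover have "{l \<in> V. l < x} = {l \<in> V - U. l < x} \<union> {l \<in> U \<inter> V. l < x}" by auto
  moreover have "card ({l \<in> U - V. l < x} \<union> {l \<in> V - U. l < x}) = ?c (U - V) + ?c (V - U)"
    "card ({l \<in> U - V. l < x} \<union> {l \<in> U \<inter> V. l < x}) = ?c (U - V) + ?c (U \<inter> V)"
    "card ({l \<in> V - U. l < x} \<union> {l \<in> U \<inter> V. l < x}) = ?c (V - U) + ?c (U \<inter> V)"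
    using assms by (intro card_Un_disjoint; auto)+
  ultimately have "?c U + ?c V = ?c (sym_diff U V) + 2 * ?c (U \<inter> V)" by simp
  then have "(- 1 :: 'a) ^ (?c U + ?c V) = (- 1) ^ ?c (sym_diff U V)"
    by (simp add: power_add)
  then show ?thesis by (simp add: pos_sign_def power_add)
qed

text \<open>The pairs with \<open>y < z\<close> are matched with those with \<open>z < y\<close>.
  Showing merely that the sum equals its own negative would not suffice when 2 is a zero
  divisor.\<close>

lemma sum_antisymmetric_pairs:
  fixes f :: "'i::linorder \<Rightarrow> 'i \<Rightarrow> 'a::ab_group_add"
  assumes "finite W" and antisym: "\<And>y z. y \<in> W \<Longrightarrow> z \<in> W \<Longrightarrow> y \<noteq> z \<Longrightarrow> f y z = - f z y"
  shows "(\<Sum>y\<in>W. \<Sum>z\<in>W - {y}. f y z) = 0"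
proof -
  have "(\<Sum>y\<in>W. \<Sum>z\<in>W - {y}. f y z)
      = (\<Sum>y\<in>W. (\<Sum>z\<in>{z\<in>W. y < z}. f y z) + (\<Sum>z\<in>{z\<in>W. z < y}. f y z))"
  proof (rule sum.cong)
    fix y
    have "W - {y} = {z\<in>W. y < z} \<union> {z\<in>W. z < y}" by auto
    then show "(\<Sum>z\<in>W - {y}. f y z) = (\<Sum>z\<in>{z\<in>W. y < z}. f y z) + (\<Sum>z\<in>{z\<in>W. z < y}. f y z)"
      using assms(1) by (simp add: sum.union_disjoint disjoint_iff not_less_iff_gr_or_eq)
  qed simp
  also have "\<dots> = (\<Sum>y\<in>W. \<Sum>z\<in>{z\<in>W. y < z}. f y z) + (\<Sum>y\<in>W. \<Sum>z\<in>{z\<in>W. z < y}. f y z)"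
    by (rule sum.distrib)
  also have "(\<Sum>y\<in>W. \<Sum>z\<in>{z\<in>W. z < y}. f y z) = (\<Sum>z\<in>W. \<Sum>y\<in>{y\<in>W. z < y}. f y z)"
    by (rule sum.swap_restrict) (use assms(1) in auto)
  also have "\<dots> = (\<Sum>z\<in>W. \<Sum>y\<in>{y\<in>W. z < y}. - f z y)"
    by (intro sum.cong refl antisym) auto
  finally show ?thesis by (simp add: sum_negf)
qed

section \<open>Pfaffians indexed by finite sets\<close>

text \<open>Indexing by a set instead of a submatrix keeps the names of the rows when some are
  deleted, so no renumbering enters the sign computations. Infinite sets get the default value
  0.\<close>

function set_pfaffian :: "('i::linorder \<Rightarrow> 'i \<Rightarrow> 'a::comm_ring_1) \<Rightarrow> 'i set \<Rightarrow> 'a" where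
  "set_pfaffian a J =
     (if infinite J then 0
      else if J = {} then 1
      else (\<Sum>y\<in>J - {Min J}. pos_sign (J - {Min J}) y * a (Min J) y
              * set_pfaffian a (J - {Min J} - {y})))"
  by pat_completeness auto
termination
proof (relation "measure (\<lambda>(a, J). card J)", goal_cases)
  case (2 a J y)
  then have "J - {Min J} - {y} \<subset> J" by auto
  then have "card (J - {Min J} - {y}) < card J" using 2 psubset_card_mono by blast
  then show ?case by simp
qed simp

declare set_pfaffian.simps [simp del]

text \<open>The expansion of the Pfaffian of the sequence formed by \<open>x\<close> followed by \<open>V\<close> in
  increasing order, along its first row.\<close>

definition row_expansion :: "('i::linorder \<Rightarrow> 'i \<Rightarrow> 'a::comm_ring_1) \<Rightarrow> 'i \<Rightarrow> 'i set \<Rightarrow> 'a" where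
  "row_expansion a x V = (\<Sum>y\<in>V. pos_sign V y * a x y * set_pfaffian a (V - {y}))"

lemma set_pfaffian_empty [simp]: "set_pfaffian a {} = 1"
  by (simp add: set_pfaffian.simps)

lemma set_pfaffian_insert_min:
  assumes "finite W" "\<And>y. y \<in> W \<Longrightarrow> m < y"
  shows "set_pfaffian a (insert m W) = row_expansion a m W"
proof -
  have "Min (insert m W) = m" by (rule Min_eqI) (use assms in \<open>auto simp: less_imp_le\<close>)
  moreover have "insert m W - {m} = W" using assms by auto
  ultimately show ?thesis
    using assms by (subst set_pfaffian.simps) (simp add: row_expansion_def)
qed

lemma finite_min_split:
  fixes V :: "'i::linorder set"
  assumes "finite V" "V \<noteq> {}"
  obtains m W where "V = insert m W" "m \<notin> W" "\<And>y. y \<in> W \<Longrightarrow> m < y"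
proof (rule that[of "Min V" "V - {Min V}"])
  show "V = insert (Min V) (V - {Min V})" using assms by (auto simp: insert_absorb)
  show "Min V < y" if "y \<in> V - {Min V}" for y
    using that assms by (metis DiffD1 DiffD2 Min_le antisym_conv2 insertI1)
qed auto

text \<open>The expansion removes two elements at a time, so an odd set ends in a singleton, whose
  expansion is an empty sum.\<close>

lemma set_pfaffian_odd:
  assumes "odd (card J)"
  shows "set_pfaffian a J = 0"
  using assms
proof (induction "card J" arbitrary: J rule: less_induct)
  case less
  have fin: "finite J" and ne: "J \<noteq> {}"
    using less.prems card.infinite by fastforce+
  obtain m W where V: "J = insert m W" "m \<notin> W" "\<And>y. y \<in> W \<Longrightarrow> m < y"
    by (rule finite_min_split[OF fin ne]) blast
  have fW: "finite W" using fin V by simp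
  have "set_pfaffian a (W - {y}) = 0" if "y \<in> W" for y
  proof (rule less.hyps)
    have "card W > 0" using that fW by (auto simp: card_gt_0_iff)
    then show "card (W - {y}) < card J" "odd (card (W - {y}))"
      using that fW V less.prems by (auto simp: card_Diff_singleton)
  qed
  then show ?case unfolding V(1) by (simp add: set_pfaffian_insert_min fW V(3) row_expansion_def)
qed

text \<open>Only the relative order of the indices enters the recursion. This is what permits the
  renumbering of rows in a principal submatrix.\<close>

lemma set_pfaffian_image:
  assumes "finite K" "strict_mono_on K f"
  shows "set_pfaffian a (f ` K) = set_pfaffian (\<lambda>i j. a (f i) (f j)) K"
  using assms
proof (induction "card K" arbitrary: K rule: less_induct)
  case less
  show ?case
  proof (cases "K = {}")
    case False
    obtain m W where V: "K = insert m W" "m \<notin> W" "\<And>y. y \<in> W \<Longrightarrow> m < y"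
      by (rule finite_min_split[OF less.prems(1) False]) blast
    have fW: "finite W" using less.prems V by simp
    have mono: "x < y \<Longrightarrow> f x < f y" if "x \<in> K" "y \<in> K" for x y
      using less.prems(2) that by (auto simp: strict_mono_on_def)
    have less_iff: "f x < f y \<longleftrightarrow> x < y" if "x \<in> K" "y \<in> K" for x y
      using mono[OF that] mono[OF that(2,1)] by (metis less_asym neqE)
    have inj: "inj_on f K" using less.prems(2) by (rule strict_mono_on_imp_inj_on)
    have injW: "inj_on f W" using inj V(1) by (auto intro: inj_on_subset)
    have sign: "pos_sign (f ` W) (f y) = pos_sign W y" if "y \<in> W" for y
    proof -
      have "{l \<in> f ` W. l < f y} = f ` {l \<in> W. l < y}" using that less_iff V(1) by auto
      moreover have "inj_on f {l \<in> W. l < y}" using injW by (rule inj_on_subset) auto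
      ultimately show ?thesis by (simp add: pos_sign_def card_image)
    qed
    have rem: "set_pfaffian a (f ` W - {f y}) = set_pfaffian (\<lambda>i j. a (f i) (f j)) (W - {y})"
      if "y \<in> W" for y
    proof -
      have "f ` W - {f y} = f ` (W - {y})" using injW that by (auto simp: inj_on_def)
      moreover have "card (W - {y}) < card K" using fW V that
        by (metis card_Diff1_less card_insert_disjoint less_SucI)
      moreover have "strict_mono_on (W - {y}) f"
        using less.prems(2) V(1) by (auto simp: strict_mono_on_def)
      ultimately show ?thesis using less.hyps[of "W - {y}"] fW by simp
    qed
    have "set_pfaffian a (f ` K) = row_expansion a (f m) (f ` W)"
      unfolding V(1) image_insert
      by (rule set_pfaffian_insert_min) (use fW V mono in auto)
    also have "\<dots> = row_expansion (\<lambda>i j. a (f i) (f j)) m W"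
      by (simp add: row_expansion_def sum.reindex[OF injW] sign rem cong: sum.cong)
    also have "\<dots> = set_pfaffian (\<lambda>i j. a (f i) (f j)) K"
      unfolding V(1) using fW V(3) by (simp add: set_pfaffian_insert_min)
    finally show ?thesis .
  qed simp
qed

lemma set_pfaffian_cong:
  assumes "\<And>i j. i \<in> J \<Longrightarrow> j \<in> J \<Longrightarrow> a i j = b i j"
  shows "set_pfaffian a J = set_pfaffian b J"
  using assms
proof (induction "card J" arbitrary: J rule: less_induct)
  case less
  consider "infinite J" | "J = {}" | "finite J" "J \<noteq> {}" by blast
  then show ?case
  proof cases
    case 3
    obtain m W where V: "J = insert m W" "m \<notin> W" "\<And>y. y \<in> W \<Longrightarrow> m < y"
      by (rule finite_min_split[OF 3]) blast
    have fW: "finite W" using 3 V by simp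
    have "set_pfaffian a (W - {y}) = set_pfaffian b (W - {y})" if "y \<in> W" for y
      by (rule less.hyps)
        (use that V fW less.prems in \<open>auto simp: card_Diff1_less less_SucI\<close>)
    then show ?thesis unfolding V(1)
      using less.prems V(1)
      by (auto simp: set_pfaffian_insert_min fW V(3) row_expansion_def intro!: sum.cong)
  qed (simp_all add: set_pfaffian.simps)
qed

text \<open>Removing the smaller of two elements shifts the position of the larger one, but not
  conversely; so exactly one sign changes.\<close>

lemma pos_sign_swap:
  assumes "finite W" "y \<in> W" "z \<in> W" "y \<noteq> z"
  shows "pos_sign W y * pos_sign (W - {y}) z
       = - (pos_sign W z * pos_sign (W - {z}) y :: 'a::comm_ring_1)"
  using assms by (cases "y < z") (auto simp: pos_sign_remove)

section \<open>Expansion along an arbitrary row and the Wick equations\<close>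

text \<open>The laws range over the whole index type, so matrix entries are extended by 0 later.
  \<open>diag\<close> is separate because \<open>skew\<close> only says that twice a diagonal value
  is 0.\<close>

locale alternating_form =
  fixes a :: "'i::linorder \<Rightarrow> 'i \<Rightarrow> 'a::comm_ring_1"
  assumes skew: "a j i = - a i j" and diag: "a i i = 0"
begin

text \<open>Expanding the smaller Pfaffians along their least element \<open>m\<close> and exchanging the two
  summations moves \<open>x\<close> past \<open>m\<close>.\<close>

lemma row_expansion_insert_min:
  assumes fin: "finite W" and min: "\<And>y. y \<in> W \<Longrightarrow> m < y"
  shows "row_expansion a x (insert m W)
       = a x m * set_pfaffian a W
         - (\<Sum>y\<in>W. \<Sum>z\<in>W - {y}. pos_sign W y * pos_sign (W - {y}) z * a x y * a m z
              * set_pfaffian a (W - {y} - {z}))" (is "_ = _ - ?S")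
    and "row_expansion a x (insert m W)
       = a x m * set_pfaffian a W + (\<Sum>z\<in>W. pos_sign W z * a m z * row_expansion a x (W - {z}))"
proof -
  have nm: "m \<notin> W" using min by blast
  have sm: "pos_sign (insert m W) m = (1::'a)" by (rule pos_sign_least) (use min in \<open>auto simp: less_imp_le\<close>)
  have "row_expansion a x (insert m W) = a x m * set_pfaffian a W
      + (\<Sum>y\<in>W. pos_sign (insert m W) y * a x y * set_pfaffian a (insert m W - {y}))"
    using fin nm by (simp add: row_expansion_def sm)
  \<comment> \<open>Since \<open>m\<close> precedes every \<open>y\<close>, inserting it flips each
    sign \<open>pos_sign W y\<close>. This is the source of the minus before the double sum.\<close>
  also have "(\<Sum>y\<in>W. pos_sign (insert m W) y * a x y * set_pfaffian a (insert m W - {y}))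
      = (\<Sum>y\<in>W. - (\<Sum>z\<in>W - {y}. pos_sign W y * pos_sign (W - {y}) z * a x y * a m z
              * set_pfaffian a (W - {y} - {z})))"
  proof (rule sum.cong)
    fix y assume y: "y \<in> W"
    have "insert m W - {y} = insert m (W - {y})" using y nm by auto
    then have "set_pfaffian a (insert m W - {y}) = row_expansion a m (W - {y})"
      using set_pfaffian_insert_min[of "W - {y}" m a] fin min by simp
    then show "pos_sign (insert m W) y * a x y * set_pfaffian a (insert m W - {y})
      = - (\<Sum>z\<in>W - {y}. pos_sign W y * pos_sign (W - {y}) z * a x y * a m z
              * set_pfaffian a (W - {y} - {z}))"
      using fin nm min[OF y]
      by (simp add: pos_sign_insert row_expansion_def sum_distrib_left sum_negf mult_ac)
  qed simp
  finally show 1: "row_expansion a x (insert m W) = a x m * set_pfaffian a W - ?S"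
    by (simp add: sum_negf)
  have "?S = (\<Sum>y\<in>W. \<Sum>z\<in>{z\<in>W. y \<noteq> z}. pos_sign W y * pos_sign (W - {y}) z * a x y * a m z
              * set_pfaffian a (W - {y} - {z}))"
    by (intro sum.cong) auto
  also have "\<dots> = (\<Sum>z\<in>W. \<Sum>y\<in>{y\<in>W. y \<noteq> z}. pos_sign W y * pos_sign (W - {y}) z * a x y * a m z
              * set_pfaffian a (W - {y} - {z}))"
    using fin by (intro sum.swap_restrict) auto
  also have "\<dots> = (\<Sum>z\<in>W. - (pos_sign W z * a m z * row_expansion a x (W - {z})))"
  proof (rule sum.cong)
    fix z assume z: "z \<in> W"
    have "(\<Sum>y\<in>{y\<in>W. y \<noteq> z}. pos_sign W y * pos_sign (W - {y}) z * a x y * a m z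
              * set_pfaffian a (W - {y} - {z}))
       = (\<Sum>y\<in>W - {z}. - (pos_sign W z * pos_sign (W - {z}) y) * a x y * a m z
              * set_pfaffian a (W - {z} - {y}))"
    proof (rule sum.cong)
      fix y assume "y \<in> W - {z}"
      moreover have "W - {y} - {z} = W - {z} - {y}" by auto
      ultimately show "pos_sign W y * pos_sign (W - {y}) z * a x y * a m z
              * set_pfaffian a (W - {y} - {z})
          = - (pos_sign W z * pos_sign (W - {z}) y) * a x y * a m z
              * set_pfaffian a (W - {z} - {y})"
        using pos_sign_swap[of W y z, where ?'a = 'a] fin z by simp
    qed auto
    also have "\<dots> = - (pos_sign W z * a m z * row_expansion a x (W - {z}))"
      by (simp add: row_expansion_def sum_distrib_left sum_negf mult_ac)
    finally show "(\<Sum>y\<in>{y\<in>W. y \<noteq> z}. pos_sign W y * pos_sign (W - {y}) z * a x y * a m z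
              * set_pfaffian a (W - {y} - {z}))
        = - (pos_sign W z * a m z * row_expansion a x (W - {z}))" .
  qed simp
  finally show "row_expansion a x (insert m W)
       = a x m * set_pfaffian a W + (\<Sum>z\<in>W. pos_sign W z * a m z * row_expansion a x (W - {z}))"
    using 1 by (simp add: sum_negf)
qed

text \<open>A Pfaffian with a repeated row vanishes, and moving \<open>x\<close> from the front to
  its place in the order costs one sign per element passed. The induction passes the least element
  \<open>m\<close> of \<open>V\<close>, with cases according to whether \<open>x\<close> lies below,
  at or above \<open>m\<close>.\<close>

lemma row_expansion_eq:
  assumes "finite V"
  shows "row_expansion a x V = (if x \<in> V then 0 else pos_sign V x * set_pfaffian a (insert x V))"
  using assms
proof (induction "card V" arbitrary: V rule: less_induct)
  case less
  show ?case
  proof (cases "\<forall>y\<in>V. x < y")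
    case True
    then have "pos_sign V x = (1::'a)" by (simp add: pos_sign_least less_imp_le)
    then show ?thesis using True less.prems by (auto simp: set_pfaffian_insert_min)
  next
    case False
    then have ne: "V \<noteq> {}" by auto
    obtain m W where V: "V = insert m W" "m \<notin> W" "\<And>y. y \<in> W \<Longrightarrow> m < y"
      by (rule finite_min_split[OF less.prems ne]) blast
    have fW: "finite W" using less.prems V by simp
    have mx: "m \<le> x" using False V by (auto simp: not_less intro: order.trans less_imp_le)
    have IH: "row_expansion a x (W - {z})
        = (if x \<in> W - {z} then 0 else pos_sign (W - {z}) x * set_pfaffian a (insert x (W - {z})))"
      if "z \<in> W" for z
      by (rule less.hyps) (use that V fW in \<open>auto simp: card_Diff1_less less_SucI\<close>)
    consider "x = m" | "m < x" "x \<in> W" | "m < x" "x \<notin> W" using mx by fastforce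
    then show ?thesis
    proof cases
      case 1
      \<comment> \<open>For \<open>x = m\<close> the entries \<open>a m y\<close> and
        \<open>a m z\<close> play the same role, so exchanging \<open>y\<close> and \<open>z\<close>
        changes only the sign.\<close>
      have "(\<Sum>y\<in>W. \<Sum>z\<in>W - {y}. pos_sign W y * pos_sign (W - {y}) z * a m y * a m z
              * set_pfaffian a (W - {y} - {z})) = 0"
      proof (rule sum_antisymmetric_pairs[OF fW])
        fix y z assume yz: "y \<in> W" "z \<in> W" "y \<noteq> z"
        have "W - {y} - {z} = W - {z} - {y}" by auto
        then show "pos_sign W y * pos_sign (W - {y}) z * a m y * a m z * set_pfaffian a (W - {y} - {z})
          = - (pos_sign W z * pos_sign (W - {z}) y * a m z * a m y * set_pfaffian a (W - {z} - {y}))"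
          using pos_sign_swap[OF fW yz, where ?'a = 'a] by (simp add: mult_ac)
      qed
      then show ?thesis
        using row_expansion_insert_min(1)[OF fW V(3), of m] 1 V(1) by (simp add: diag)
    next
      case 2
      \<comment> \<open>For \<open>z\<close> other than \<open>x\<close> the row \<open>x\<close> is
        still repeated and the term vanishes by induction. The term left over cancels
        \<open>a x m * set_pfaffian a W\<close> by skew symmetry.\<close>
      have "(\<Sum>z\<in>W. pos_sign W z * a m z * row_expansion a x (W - {z}))
          = (\<Sum>z\<in>W. if z = x then a m x * set_pfaffian a W else 0)"
        by (rule sum.cong)
          (use 2 fW in \<open>auto simp: IH pos_sign_remove insert_absorb mult_ac\<close>)
      also have "\<dots> = a m x * set_pfaffian a W" using 2 fW by simp
      finally show ?thesis
        using row_expansion_insert_min(2)[OF fW V(3), of x] 2 V(1) skew[of x m] by simp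
    next
      case 3
      have min: "m < y" if "y \<in> insert x W" for y using that 3 V by auto
      \<comment> \<open>The least element of \<open>insert x V\<close> is still \<open>m\<close>.
        Expanding along it separates the column of \<open>x\<close> from terms to which the
        induction hypothesis applies.\<close>
      have "set_pfaffian a (insert x V) = row_expansion a m (insert x W)"
        using set_pfaffian_insert_min[of "insert x W" m a] fW min V(1) by (simp add: insert_commute)
      also have "\<dots> = pos_sign W x * a m x * set_pfaffian a W
          + (\<Sum>z\<in>W. pos_sign (insert x W) z * a m z * set_pfaffian a (insert x W - {z}))"
        using fW 3 by (simp add: row_expansion_def pos_sign_insert)
      also have "(\<Sum>z\<in>W. pos_sign (insert x W) z * a m z * set_pfaffian a (insert x W - {z}))
          = (\<Sum>z\<in>W. - (pos_sign W x * (pos_sign W z * a m z * row_expansion a x (W - {z}))))"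
      proof (rule sum.cong)
        fix z assume z: "z \<in> W"
        then have "insert x W - {z} = insert x (W - {z})" "x \<noteq> z" using 3 by auto
        then show "pos_sign (insert x W) z * a m z * set_pfaffian a (insert x W - {z})
          = - (pos_sign W x * (pos_sign W z * a m z * row_expansion a x (W - {z})))"
          using IH[OF z] 3 fW z
          by (cases "x < z") (auto simp: pos_sign_insert pos_sign_remove mult_ac)
      qed simp
      finally have "pos_sign V x * set_pfaffian a (insert x V)
          = a x m * set_pfaffian a W + (\<Sum>z\<in>W. pos_sign W z * a m z * row_expansion a x (W - {z}))"
        using V fW 3 skew[of x m]
        by (simp add: pos_sign_insert sum_negf ring_distribs mult.assoc flip: sum_distrib_left)
      then show ?thesis
        using row_expansion_insert_min(2)[OF fW V(3), of x] 3 V(1) by simp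
    qed
  qed
qed

text \<open>Expanding the factors \<open>Pf (x, V)\<close> for \<open>x \<in> U\<close> and \<open>Pf (y, U)\<close> for \<open>y \<in> V\<close> gives the
  same double sum, up to the sign coming from skew symmetry.\<close>

lemma wick_set_pfaffian:
  assumes fin: "finite U" "finite V"
  shows "(\<Sum>x\<in>sym_diff U V. pos_sign (sym_diff U V) x
      * set_pfaffian a (sym_diff U {x}) * set_pfaffian a (sym_diff V {x})) = 0"
proof -
  \<comment> \<open>The sum may be extended from \<open>U - V\<close> to all of \<open>U\<close>,
    because \<open>row_expansion a x V\<close> is 0 when \<open>x\<close> lies in
    \<open>V\<close>.\<close>
  have half: "(\<Sum>x\<in>U - V. pos_sign (sym_diff U V) x
      * set_pfaffian a (sym_diff U {x}) * set_pfaffian a (sym_diff V {x}))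
    = (\<Sum>x\<in>U. pos_sign U x * set_pfaffian a (U - {x}) * row_expansion a x V)"
    if fin: "finite U" "finite V" for U V
  proof (rule sum.mono_neutral_cong_left)
    fix x assume x: "x \<in> U - V"
    then have "sym_diff U {x} = U - {x}" "sym_diff V {x} = insert x V" by auto
    then show "pos_sign (sym_diff U V) x
        * set_pfaffian a (sym_diff U {x}) * set_pfaffian a (sym_diff V {x})
      = pos_sign U x * set_pfaffian a (U - {x}) * row_expansion a x V"
      unfolding pos_sign_sym_diff[OF fin]
      using x fin by (simp add: row_expansion_eq mult_ac)
  qed (use fin in \<open>auto simp: row_expansion_eq\<close>)
  have "(\<Sum>x\<in>V. pos_sign V x * set_pfaffian a (V - {x}) * row_expansion a x U)
      = (\<Sum>x\<in>V. \<Sum>y\<in>U. pos_sign V x * set_pfaffian a (V - {x})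
            * (pos_sign U y * a x y * set_pfaffian a (U - {y})))"
    by (simp add: row_expansion_def sum_distrib_left)
  also have "\<dots> = (\<Sum>y\<in>U. \<Sum>x\<in>V. pos_sign V x * set_pfaffian a (V - {x})
            * (pos_sign U y * a x y * set_pfaffian a (U - {y})))"
    by (rule sum.swap)
  also have "\<dots> = (\<Sum>y\<in>U. \<Sum>x\<in>V. - (pos_sign U y * set_pfaffian a (U - {y})
            * (pos_sign V x * a y x * set_pfaffian a (V - {x}))))"
  proof (intro sum.cong refl)
    fix x y
    show "pos_sign V x * set_pfaffian a (V - {x}) * (pos_sign U y * a x y * set_pfaffian a (U - {y}))
      = - (pos_sign U y * set_pfaffian a (U - {y}) * (pos_sign V x * a y x * set_pfaffian a (V - {x})))"
      by (subst skew) (simp add: mult_ac)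
  qed
  also have "\<dots> = - (\<Sum>x\<in>U. pos_sign U x * set_pfaffian a (U - {x}) * row_expansion a x V)"
    by (simp add: row_expansion_def sum_distrib_left sum_negf)
  finally have swap: "(\<Sum>x\<in>V. pos_sign V x * set_pfaffian a (V - {x}) * row_expansion a x U)
    = - (\<Sum>x\<in>U. pos_sign U x * set_pfaffian a (U - {x}) * row_expansion a x V)" .
  have "(\<Sum>x\<in>sym_diff U V. pos_sign (sym_diff U V) x
      * set_pfaffian a (sym_diff U {x}) * set_pfaffian a (sym_diff V {x}))
    = (\<Sum>x\<in>U - V. pos_sign (sym_diff U V) x
      * set_pfaffian a (sym_diff U {x}) * set_pfaffian a (sym_diff V {x}))
    + (\<Sum>x\<in>V - U. pos_sign (sym_diff V U) x
      * set_pfaffian a (sym_diff V {x}) * set_pfaffian a (sym_diff U {x}))"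
    using fin by (subst sum.union_disjoint) (auto simp: Un_commute mult_ac)
  then show ?thesis unfolding half[OF fin] half[OF fin(2,1)] swap by simp
qed

end

section \<open>Translation of Wick equations and matrix Pfaffians to sets\<close>

text \<open>For \<open>i\<close> in the symmetric difference the weak count exceeds the strict one
  by 1, so the whole sum changes by a factor -1.\<close>

lemma wick_equation_pos_sign:
  assumes "finite J1" "finite J2"
  shows "wick_equation v J1 J2 \<longleftrightarrow>
    (\<Sum>i\<in>sym_diff J1 J2. pos_sign (sym_diff J1 J2) i * v (sym_diff J1 {i}) * v (sym_diff J2 {i})) = 0"
proof -
  let ?D = "sym_diff J1 J2"
  have "(- 1) ^ card {l \<in> ?D. l \<le> i} * v (sym_diff J1 {i}) * v (sym_diff J2 {i})
      = - (pos_sign ?D i * v (sym_diff J1 {i}) * v (sym_diff J2 {i}))" if "i \<in> ?D" for i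
  proof -
    have "{l \<in> ?D. l \<le> i} = insert i {l \<in> ?D. l < i}" using that by auto
    then have "card {l \<in> ?D. l \<le> i} = Suc (card {l \<in> ?D. l < i})" using assms by simp
    then show ?thesis by (simp add: pos_sign_def)
  qed
  then have "(\<Sum>i\<in>?D. (- 1) ^ card {l \<in> ?D. l \<le> i} * v (sym_diff J1 {i}) * v (sym_diff J2 {i}))
      = (\<Sum>i\<in>?D. - (pos_sign ?D i * v (sym_diff J1 {i}) * v (sym_diff J2 {i})))"
    by (intro sum.cong) simp_all
  then show ?thesis unfolding wick_equation_def by (simp only: sum_negf neg_equal_0_iff_equal)
qed


text \<open>The rows of the submatrix are numbered through \<open>pick S\<close>, the increasing
  enumeration of \<open>S\<close> from 0, so \<open>set_pfaffian_image\<close> applies.\<close>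

lemma set_pfaffian_submatrix:
  assumes sq: "dim_col B = dim_row B" and S: "S \<subseteq> {..<dim_row B}"
  shows "set_pfaffian (\<lambda>i j. principal_submatrix B S $$ (i, j)) {..<card S}
    = set_pfaffian (\<lambda>i j. B $$ (i, j)) S"
proof -
  have fin: "finite S" using S finite_subset by blast
  have S_eq: "{i. i < dim_row B \<and> i \<in> S} = S" using S by auto
  have mono: "strict_mono_on {..<card S} (pick S)"
    by (auto intro!: strict_mono_onI pick_mono_le)
  have "pick S ` {..<card S} = S"
  proof (rule card_subset_eq[OF fin])
    show "pick S ` {..<card S} \<subseteq> S" by (auto intro: pick_in_set_le)
    show "card (pick S ` {..<card S}) = card S"
      using card_image[OF strict_mono_on_imp_inj_on[OF mono]] by simp
  qed
  moreover have "set_pfaffian (\<lambda>i j. principal_submatrix B S $$ (i, j)) {..<card S}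
      = set_pfaffian (\<lambda>i j. B $$ (pick S i, pick S j)) {..<card S}"
    by (rule set_pfaffian_cong) (simp add: submatrix_index S_eq sq)
  ultimately show ?thesis
    using set_pfaffian_image[OF _ mono, of "\<lambda>i j. B $$ (i, j)"] by simp
qed

lemma set_pfaffian_two:
  assumes "i < j"
  shows "set_pfaffian a {i, j} = a i j"
  using set_pfaffian_insert_min[of "{j}" i a] assms by (simp add: row_expansion_def pos_sign_least)

text \<open>The matrix recursion renumbers rows at every step, whereas the set recursion keeps the
  indices of \<open>B\<close>; \<open>set_pfaffian_submatrix\<close> translates between them in the
  induction on the size.\<close>

lemma pfaffian_eq_set_pfaffian:
  assumes "dim_col B = dim_row B"
  shows "pfaffian B = set_pfaffian (\<lambda>i j. B $$ (i, j)) {..<dim_row B}"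
  using assms
proof (induction "dim_row B" arbitrary: B rule: less_induct)
  case less
  let ?b = "\<lambda>i j. B $$ (i, j)"
  consider "dim_row B = 0" | "odd (dim_row B)" | "dim_row B = 2" | "dim_row B > 2" "even (dim_row B)"
  proof -
    have "dim_row B = 0 \<or> odd (dim_row B) \<or> dim_row B = 2 \<or> dim_row B > 2 \<and> even (dim_row B)"
      by presburger
    then show ?thesis using that by blast
  qed
  then show ?case
  proof cases
    case 1
    then show ?thesis by (simp add: pfaffian.simps)
  next
    case 2
    then have "pfaffian B = 0" by (subst pfaffian.simps) (simp add: odd_pos)
    then show ?thesis using 2 by (simp add: set_pfaffian_odd)
  next
    case 3
    have "{..<dim_row B} = {0, 1}" using 3 by auto
    then have "set_pfaffian ?b {..<dim_row B} = B $$ (0, 1)" by (simp add: set_pfaffian_two)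
    then show ?thesis using 3 by (subst pfaffian.simps) simp
  next
    case 4
    have sub: "pfaffian (principal_submatrix B S) = set_pfaffian ?b S"
      if S: "S \<subset> {..<dim_row B}" for S
    proof -
      have "{i. i < dim_row B \<and> i \<in> S} = S" using S by auto
      then have dim: "dim_row (principal_submatrix B S) = card S" "dim_col (principal_submatrix B S) = card S"
        using less.prems by (simp_all add: dim_submatrix)
      moreover have "card S < dim_row B" using psubset_card_mono[OF _ S] by simp
      ultimately show ?thesis
        using less.hyps[of "principal_submatrix B S"] set_pfaffian_submatrix[OF less.prems] S by auto
    qed
    have "set_pfaffian ?b {..<dim_row B} = row_expansion ?b 0 {1..<dim_row B}"
    proof -
      have "{..<dim_row B} = insert 0 {1..<dim_row B}" using 4 by auto
      then show ?thesis using set_pfaffian_insert_min[of "{1..<dim_row B}" 0 ?b] by simp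
    qed
    also have "\<dots> = (\<Sum>j\<in>{1..<dim_row B}. (- 1) ^ (j + 1)
              * pfaffian (principal_submatrix B {0, j})
              * pfaffian (principal_submatrix B ({1..<dim_row B} - {j})))"
      unfolding row_expansion_def
    proof (rule sum.cong)
      fix j assume j: "j \<in> {1..<dim_row B}"
      \<comment> \<open>The fact \<open>sub\<close> covers proper subsets only;
        \<open>{0, j}\<close> is one because the size exceeds 2, size 2 having been treated
        separately.\<close>
      have "card {0, j} \<le> 2" by (simp add: card_insert_if)
      then have "{0, j} \<noteq> {..<dim_row B}" using 4 by (metis card_lessThan not_le)
      then have "{0, j} \<subset> {..<dim_row B}" using j 4 by auto
      then have "pfaffian (principal_submatrix B {0, j}) = B $$ (0, j)"
        using j by (simp add: sub set_pfaffian_two)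
      moreover have "pfaffian (principal_submatrix B ({1..<dim_row B} - {j}))
          = set_pfaffian ?b ({1..<dim_row B} - {j})"
      proof (rule sub)
        have "0 \<in> {..<dim_row B}" "0 \<notin> {1..<dim_row B} - {j}" using 4 by auto
        moreover have "{1..<dim_row B} - {j} \<subseteq> {..<dim_row B}" by auto
        ultimately show "{1..<dim_row B} - {j} \<subset> {..<dim_row B}" by blast
      qed
      \<comment> \<open>The column \<open>j\<close> has \<open>j - 1\<close> predecessors here, a
        number of the same parity as \<open>j + 1\<close>.\<close>
      moreover have "{l \<in> {1..<dim_row B}. l < j} = {1..<j}" using j by auto
      then have "pos_sign {1..<dim_row B} j = (- 1 :: 'a) ^ (j + 1)"
        using j by (cases j) (simp_all add: pos_sign_def)
      ultimately show "pos_sign {1..<dim_row B} j * B $$ (0, j) * set_pfaffian ?b ({1..<dim_row B} - {j})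
        = (- 1) ^ (j + 1) * pfaffian (principal_submatrix B {0, j})
              * pfaffian (principal_submatrix B ({1..<dim_row B} - {j}))" by simp
    qed simp
    finally show ?thesis using 4 by (subst pfaffian.simps) simp
  qed
qed

lemma pfaffian_principal_submatrix:
  assumes A: "A \<in> carrier_mat n n" and S: "S \<subseteq> {..<n}"
  shows "pfaffian (principal_submatrix A S) = set_pfaffian (\<lambda>i j. A $$ (i, j)) S"
proof -
  have "{i. i < n \<and> i \<in> S} = S" using S by auto
  then show ?thesis
    using pfaffian_eq_set_pfaffian[of "principal_submatrix A S"] set_pfaffian_submatrix[of A S] A S
    by (simp add: dim_submatrix)
qed

lemma skew_symmetric_matD:
  assumes A: "A \<in> carrier_mat n n" "skew_symmetric_mat A" and ij: "i < n" "j < n"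
  shows "A $$ (j, i) = - A $$ (i, j)" "A $$ (i, i) = 0"
proof -
  have "transpose_mat A $$ (i, j) = (- A) $$ (i, j)"
    using A(2) by (simp add: skew_symmetric_mat_def)
  then show "A $$ (j, i) = - A $$ (i, j)" using A(1) ij by simp
  show "A $$ (i, i) = 0" using A ij by (auto simp: skew_symmetric_mat_def)
qed

section \<open>Scaling and twisting of Wick equations\<close>

text \<open>Every term contains two values of the vector, so the sum is multiplied by
  \<open>g * g\<close>.\<close>

lemma wick_equation_scale:
  assumes "wick_equation w J1 J2" and J: "J1 \<subseteq> E" "J2 \<subseteq> E"
    and v: "\<And>J. J \<subseteq> E \<Longrightarrow> v J = g * w J"
  shows "wick_equation v J1 J2"
proof -
  have "(\<Sum>i\<in>sym_diff J1 J2. (- 1) ^ card {l \<in> sym_diff J1 J2. l \<le> i}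
          * v (sym_diff J1 {i}) * v (sym_diff J2 {i}))
      = (\<Sum>i\<in>sym_diff J1 J2. g * g * ((- 1) ^ card {l \<in> sym_diff J1 J2. l \<le> i}
          * w (sym_diff J1 {i}) * w (sym_diff J2 {i})))"
  proof (rule sum.cong)
    fix i assume "i \<in> sym_diff J1 J2"
    then have "sym_diff J1 {i} \<subseteq> E" "sym_diff J2 {i} \<subseteq> E" using J by auto
    then show "(- 1) ^ card {l \<in> sym_diff J1 J2. l \<le> i} * v (sym_diff J1 {i}) * v (sym_diff J2 {i})
        = g * g * ((- 1) ^ card {l \<in> sym_diff J1 J2. l \<le> i}
          * w (sym_diff J1 {i}) * w (sym_diff J2 {i}))"
      by (simp only: v mult_ac)
  qed simp
  then show ?thesis
    using assms(1) unfolding wick_equation_def by (simp flip: sum_distrib_left)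
qed

lemma wick_equation_twist:
  "wick_equation (\<lambda>J. v (sym_diff J T)) J1 J2 \<longleftrightarrow> wick_equation v (sym_diff J1 T) (sym_diff J2 T)"
proof -
  have "sym_diff (sym_diff J1 T) (sym_diff J2 T) = sym_diff J1 J2" by auto
  moreover have "sym_diff (sym_diff J {i}) T = sym_diff (sym_diff J T) {i}" for J i by auto
  ultimately show ?thesis by (simp only: wick_equation_def)
qed

section \<open>Recovering a normalised vector from its 4-term Wick equations\<close>

text \<open>Of the exchange axiom, \<open>exch\<close> retains the instance in which the second
  basis is \<open>{}\<close>, so that the symmetric difference is \<open>J\<close> itself.\<close>

lemma four_term_wick_determines_pfaffian:
  fixes w :: "nat set \<Rightarrow> 'a::comm_ring_1"
  assumes "alternating_form a" and "finite E"
    and empty: "w {} = 1"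
    and pair: "\<And>i j. i \<in> E \<Longrightarrow> j \<in> E \<Longrightarrow> i < j \<Longrightarrow> w {i, j} = a i j"
    and exch: "\<And>J x. J \<subseteq> E \<Longrightarrow> w J \<noteq> 0 \<Longrightarrow> x \<in> J \<Longrightarrow> \<exists>y\<in>J. y \<noteq> x \<and> w (J - {x, y}) \<noteq> 0"
    and unit: "\<And>J. J \<subseteq> E \<Longrightarrow> w J \<noteq> 0 \<Longrightarrow> w J dvd 1"
    and wick: "\<And>J1 J2. J1 \<subseteq> E \<Longrightarrow> J2 \<subseteq> E \<Longrightarrow> card (sym_diff J1 J2) = 4 \<Longrightarrow> wick_equation w J1 J2"
    and "J \<subseteq> E"
  shows "w J = set_pfaffian a J"
  using \<open>J \<subseteq> E\<close>
proof (induction "card J" arbitrary: J rule: less_induct)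
  case less
  interpret alternating_form a by fact
  have fin: "finite J" using less.prems \<open>finite E\<close> finite_subset by blast
  have IH: "w J' = set_pfaffian a J'" if "J' \<subset> J" for J'
    using less.hyps[of J'] psubset_card_mono[OF fin that] that less.prems by auto
  \<comment> \<open>The split asks whether deleting some two elements from \<open>J\<close> leaves a
    nonzero value. If so, one more exchange gives the set \<open>K\<close>, unless \<open>J\<close>
    has only two elements.\<close>
  consider "J = {}" | "J \<noteq> {}" "\<forall>x\<in>J. \<forall>y\<in>J. x \<noteq> y \<longrightarrow> w (J - {x, y}) = 0"
    | x y where "x \<in> J" "y \<in> J" "x \<noteq> y" "w (J - {x, y}) \<noteq> 0" by blast
  then show ?case
  proof cases
    case 1
    then show ?thesis by (simp add: empty)
  next
    case 2
    obtain m W where V: "J = insert m W" "m \<notin> W" "\<And>y. y \<in> W \<Longrightarrow> m < y"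
      by (rule finite_min_split[OF fin 2(1)]) blast
    have m: "m \<in> J" using V(1) by simp
    have "w J = 0"
    proof (rule ccontr)
      assume "w J \<noteq> 0"
      then obtain y where "y \<in> J" "y \<noteq> m" "w (J - {m, y}) \<noteq> 0"
        using exch[OF less.prems _ m] by blast
      then show False using 2(2) m by metis
    qed
    moreover have "set_pfaffian a (W - {y}) = 0" if "y \<in> W" for y
    proof -
      have y: "y \<in> J" "m \<noteq> y" and "J - {m, y} = W - {y}" "W - {y} \<subset> J"
        using V that by auto
      moreover have "w (J - {m, y}) = 0" using 2(2) m y by blast
      ultimately show ?thesis using IH[of "W - {y}"] by simp
    qed
    then have "set_pfaffian a J = 0"
      unfolding V(1) using set_pfaffian_insert_min[of W m a] V fin by (simp add: row_expansion_def)
    ultimately show ?thesis by simp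
  next
    case (3 x y)
    show ?thesis
    proof (cases "J = {x, y}")
      case True
      have "w {i, j} = set_pfaffian a {i, j}" if "i \<in> J" "j \<in> J" "i < j" for i j
        using pair[of i j] that less.prems by (auto simp: set_pfaffian_two)
      moreover have "x < y \<or> y < x" using 3(3) by auto
      ultimately show ?thesis using 3(1,2) True by (metis insert_commute)
    next
      case False
      then obtain x' where x': "x' \<in> J - {x, y}" using 3 by blast
      obtain y' where y': "y' \<in> J - {x, y}" "y' \<noteq> x'" "w (J - {x, y} - {x', y'}) \<noteq> 0"
        using exch[of "J - {x, y}" x'] 3 x' less.prems by blast
      define K where "K = J - {x, y} - {x', y'}"
      define D where "D = {y, x', y'}"
      have JD: "J = insert x (D \<union> K)" "x \<notin> D \<union> K" "D \<inter> K = {}"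
        using 3 x' y' by (auto simp: K_def D_def)
      have finD: "finite D" "finite K" using fin by (auto simp: K_def D_def)
      have card: "card (insert x D) = 4" using 3 x' y' by (auto simp: D_def)
      \<comment> \<open>Toggling \<open>x\<close> turns \<open>J1\<close> into \<open>K\<close> and
        \<open>J2\<close> into \<open>J\<close>. Toggling any other element of
        \<open>insert x D\<close> gives two proper subsets of \<open>J\<close>, so
        \<open>w J\<close> is the only value in this Wick equation not known by induction.\<close>
      define J1 J2 where "J1 = insert x K" and "J2 = D \<union> K"
      have diff: "sym_diff J1 J2 = insert x D" using JD by (auto simp: J1_def J2_def)
      have sub: "J1 \<subseteq> E" "J2 \<subseteq> E" "finite J1" "finite J2"
        using JD finD less.prems by (auto simp: J1_def J2_def)
      have x_diff: "sym_diff J1 {x} = K" "sym_diff J2 {x} = J"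
        using JD by (auto simp: J1_def J2_def)
      let ?s = "\<lambda>v i. pos_sign (insert x D) i * v (sym_diff J1 {i}) * v (sym_diff J2 {i})"
      have KJ: "w K = set_pfaffian a K" by (rule IH) (use JD in auto)
      have rest: "(\<Sum>i\<in>D. ?s w i) = (\<Sum>i\<in>D. ?s (set_pfaffian a) i)"
      proof (rule sum.cong)
        fix i assume i: "i \<in> D"
        have "sym_diff J1 {i} = insert x (insert i K)" "sym_diff J2 {i} = D \<union> K - {i}"
          using i JD by (auto simp: J1_def J2_def)
        moreover have "insert x (insert i K) \<subset> J"
        proof -
          obtain d where "d \<in> D" "d \<noteq> i" using x' y' by (auto simp: D_def)
          then show ?thesis using i JD by auto
        qed
        moreover have "D \<union> K - {i} \<subset> J" using JD by auto
        ultimately show "?s w i = ?s (set_pfaffian a) i" by (simp add: IH)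
      qed simp
      have split: "(\<Sum>i\<in>insert x D. ?s v i)
          = pos_sign (insert x D) x * (v K * v J) + (\<Sum>i\<in>D. ?s v i)" for v :: "nat set \<Rightarrow> 'a"
        using JD(2) finD(1) by (simp add: x_diff mult.assoc)
      have "(\<Sum>i\<in>insert x D. ?s w i) = 0"
        using wick[OF sub(1,2)] card wick_equation_pos_sign[OF sub(3,4), of w] unfolding diff by simp
      also have "0 = (\<Sum>i\<in>insert x D. ?s (set_pfaffian a) i)"
        using wick_set_pfaffian[OF sub(3,4)] unfolding diff by simp
      finally have "pos_sign (insert x D) x * (w K * w J)
          = pos_sign (insert x D) x * (w K * set_pfaffian a J)"
        unfolding split rest KJ by simp
      then have *: "w K * w J = w K * set_pfaffian a J"
        by (metis pos_sign_square_left)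
      \<comment> \<open>The ring may have zero divisors, so \<open>w K\<close> is cancelled by means
        of an inverse.\<close>
      have "w K dvd 1" by (rule unit) (use JD less.prems y' in \<open>auto simp: K_def\<close>)
      then obtain h where h: "1 = w K * h" by (elim dvdE)
      have cancel: "h * (w K * z) = z" for z
      proof -
        have "h * (w K * z) = (w K * h) * z" by (simp only: mult_ac)
        then show ?thesis by (simp flip: h)
      qed
      show ?thesis using arg_cong[OF *, of "(*) h"] by (simp only: cancel)
    qed
  qed
qed

lemma orthogonal_matroidD:
  assumes "orthogonal_matroid E \<B>" "B1 \<in> \<B>" "B2 \<in> \<B>" "x \<in> sym_diff B1 B2"
  shows "\<exists>y\<in>sym_diff B1 B2. y \<noteq> x \<and> sym_diff B1 {x, y} \<in> \<B>"
  using assms unfolding orthogonal_matroid_def by blast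

section \<open>Representatives of a point over a partial field\<close>

context partial_field
begin

lemma inverse_mem:
  assumes "g \<in> G"
  obtains h where "h \<in> G" "g * h = 1"
  using units[OF assms] inverse_closed[OF assms] by (metis dvdE)

lemma pf_elements_mult: "g \<in> G \<Longrightarrow> x \<in> pf_elements G \<Longrightarrow> g * x \<in> pf_elements G"
  using mult_closed by (auto simp: pf_elements_def)

lemma pf_elements_uminus: "x \<in> pf_elements G \<Longrightarrow> - x \<in> pf_elements G"
  using pf_elements_mult[OF uminus_one_mem] by force

lemma mult_eq_0_iff_mem:
  assumes "g \<in> G"
  shows "g * x = 0 \<longleftrightarrow> x = 0"
  using inverse_mem[OF assms] by (metis mult.commute mult.left_commute mult_1 mult_zero_right)

lemma proj_spaceE:
  assumes "p \<in> proj_space G n"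
  obtains u where "u \<in> pf_vectors G n"
    "p = {v \<in> pf_vectors G n. \<exists>g\<in>G. \<forall>J\<in>Pow {..<n}. v J = g * u J}"
  using assms by (auto simp: proj_space_def scaling_rel_def elim!: quotientE)

lemma proj_space_subset: "p \<in> proj_space G n \<Longrightarrow> v \<in> p \<Longrightarrow> v \<in> pf_vectors G n"
  by (elim proj_spaceE) auto

lemma proj_space_nonempty: "p \<in> proj_space G n \<Longrightarrow> p \<noteq> {}"
  using one_mem by (elim proj_spaceE) force

lemma proj_space_related:
  assumes "p \<in> proj_space G n" "v \<in> p" "w \<in> p"
  shows "\<exists>g\<in>G. \<forall>J\<in>Pow {..<n}. w J = g * v J"
proof -
  obtain u where "p = {v \<in> pf_vectors G n. \<exists>g\<in>G. \<forall>J\<in>Pow {..<n}. v J = g * u J}"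
    using assms(1) by (rule proj_spaceE)
  then obtain g g' where g: "g \<in> G" "\<forall>J\<in>Pow {..<n}. v J = g * u J"
    and g': "g' \<in> G" "\<forall>J\<in>Pow {..<n}. w J = g' * u J"
    using assms by blast
  obtain h where h: "h \<in> G" "g * h = 1" using g(1) by (rule inverse_mem)
  have "w J = g' * h * v J" if "J \<in> Pow {..<n}" for J
  proof -
    have "g' * h * v J = g' * (g * h) * u J" using that g by (simp add: mult_ac)
    then show ?thesis using that g' h by simp
  qed
  then show ?thesis using mult_closed[OF g'(1) h(1)] by blast
qed

text \<open>This serves to normalise a representative at a chosen basis. The restriction keeps the
  scaled vector extensional, as \<open>pf_vectors\<close> demands.\<close>

lemma proj_space_scale:
  assumes p: "p \<in> proj_space G n" "v \<in> p" and g: "g \<in> G"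
  shows "restrict (\<lambda>J. g * v J) (Pow {..<n}) \<in> p"
proof -
  obtain u where u: "p = {v \<in> pf_vectors G n. \<exists>g\<in>G. \<forall>J\<in>Pow {..<n}. v J = g * u J}"
    using p(1) by (rule proj_spaceE)
  obtain g' where g': "g' \<in> G" "\<forall>J\<in>Pow {..<n}. v J = g' * u J" using p u by blast
  have v: "v \<in> pf_vectors G n" using p by (rule proj_space_subset)
  then have "restrict (\<lambda>J. g * v J) (Pow {..<n}) \<in> pf_vectors G n"
    using pf_elements_mult[OF g] mult_eq_0_iff_mem[OF g] by (auto simp: pf_vectors_def PiE_iff)
  moreover have "\<forall>J\<in>Pow {..<n}. restrict (\<lambda>J. g * v J) (Pow {..<n}) J = (g * g') * u J"
    using g' by (simp add: mult_ac)
  ultimately show ?thesis unfolding u using mult_closed[OF g g'(1)] by blast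
qed

lemma pf_vectors_mem:
  assumes "v \<in> pf_vectors G n" "J \<subseteq> {..<n}"
  shows "v J \<in> pf_elements G" "v J \<noteq> 0 \<Longrightarrow> v J \<in> G"
  using assms by (auto simp: pf_vectors_def pf_elements_def PiE_iff)

section \<open>The cycle of implications\<close>

lemma pfaffian_imp_strong:
  assumes p: "p \<in> proj_space G n" and A: "A \<in> carrier_mat n n" "skew_symmetric_mat A"
    and T: "T \<subseteq> {..<n}" and w: "w \<in> p"
    and wA: "\<forall>J\<in>Pow {..<n}. w J = pfaffian (principal_submatrix A (sym_diff J T))"
  shows "strong_orthogonal_matroid G n p"
proof -
  define a where "a i j = (if i < n \<and> j < n then A $$ (i, j) else 0)" for i j
  interpret alternating_form a
  proof
    show "a j i = - a i j" for i j using skew_symmetric_matD(1)[OF A, of i j] by (simp add: a_def)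
    show "a i i = 0" for i using skew_symmetric_matD(2)[OF A, of i i] by (simp add: a_def)
  qed
  have wP: "w J = set_pfaffian a (sym_diff J T)" if J: "J \<subseteq> {..<n}" for J
  proof -
    have sub: "sym_diff J T \<subseteq> {..<n}" using J T by auto
    have "w J = set_pfaffian (\<lambda>i j. A $$ (i, j)) (sym_diff J T)"
      using wA J pfaffian_principal_submatrix[OF A(1) sub] by simp
    also have "\<dots> = set_pfaffian a (sym_diff J T)"
      by (rule set_pfaffian_cong) (use sub in \<open>auto simp: a_def\<close>)
    finally show ?thesis .
  qed
  have "wick_equation v J1 J2" if v: "v \<in> p" and J: "J1 \<subseteq> {..<n}" "J2 \<subseteq> {..<n}" for v J1 J2
  proof -
    obtain g where "\<forall>J\<in>Pow {..<n}. v J = g * w J"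
      using proj_space_related[OF p w v] by blast
    then have v: "\<And>J. J \<subseteq> {..<n} \<Longrightarrow> v J = g * set_pfaffian a (sym_diff J T)"
      by (simp add: wP)
    have "finite J1" "finite J2" "finite T" using J T finite_subset by blast+
    then have "wick_equation (set_pfaffian a) (sym_diff J1 T) (sym_diff J2 T)"
      using wick_set_pfaffian by (subst wick_equation_pos_sign) auto
    then have "wick_equation (\<lambda>J. set_pfaffian a (sym_diff J T)) J1 J2"
      unfolding wick_equation_twist .
    then show ?thesis using J v by (rule wick_equation_scale)
  qed
  then show ?thesis using p by (simp add: strong_orthogonal_matroid_def)
qed

lemma strong_imp_weak:
  assumes "strong_orthogonal_matroid G n p"
  shows "weak_orthogonal_matroid G n p"
proof -
  have p: "p \<in> proj_space G n"
    and wick: "\<And>v J1 J2. v \<in> p \<Longrightarrow> J1 \<subseteq> {..<n} \<Longrightarrow> J2 \<subseteq> {..<n} \<Longrightarrow> wick_equation v J1 J2"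
    using assms by (auto simp: strong_orthogonal_matroid_def)
  have "orthogonal_matroid {..<n} {J \<in> Pow {..<n}. v J \<noteq> 0}" if v: "v \<in> p" for v
  proof -
    have vP: "v \<in> pf_vectors G n" using p v by (rule proj_space_subset)
    have "\<exists>y\<in>sym_diff B1 B2. y \<noteq> x \<and> v (sym_diff B1 {x, y}) \<noteq> 0"
      if B: "B1 \<subseteq> {..<n}" "v B1 \<noteq> 0" "B2 \<subseteq> {..<n}" "v B2 \<noteq> 0" and x: "x \<in> sym_diff B1 B2"
      for B1 B2 x
    proof (rule ccontr)
      assume no: "\<not> ?thesis"
      let ?D = "sym_diff B1 B2"
      \<comment> \<open>With this choice the term at \<open>x\<close> is, up to sign,
        \<open>v B1 * v B2\<close>. Every other term has a factor
        \<open>v (sym_diff B1 {x, i})\<close>, which is 0 if the exchange fails.\<close>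
      let ?J1 = "sym_diff B1 {x}" and ?J2 = "sym_diff B2 {x}"
      have fin: "finite B1" "finite B2" using B finite_subset by blast+
      have J: "?J1 \<subseteq> {..<n}" "?J2 \<subseteq> {..<n}" using B x by auto
      have D: "sym_diff ?J1 ?J2 = ?D" by auto
      have "(\<Sum>i\<in>?D. pos_sign ?D i * v (sym_diff ?J1 {i}) * v (sym_diff ?J2 {i})) = 0"
        using wick[OF v J] wick_equation_pos_sign[of ?J1 ?J2 v] fin unfolding D by blast
      moreover have "(\<Sum>i\<in>?D. pos_sign ?D i * v (sym_diff ?J1 {i}) * v (sym_diff ?J2 {i}))
          = (\<Sum>i\<in>?D. if i = x then pos_sign ?D x * (v B1 * v B2) else 0)"
      proof (rule sum.cong)
        fix i assume i: "i \<in> ?D"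
        show "pos_sign ?D i * v (sym_diff ?J1 {i}) * v (sym_diff ?J2 {i})
          = (if i = x then pos_sign ?D x * (v B1 * v B2) else 0)"
        proof (cases "i = x")
          case True
          then have "sym_diff ?J1 {i} = B1" "sym_diff ?J2 {i} = B2" by auto
          then show ?thesis using True by (simp only: mult.assoc refl if_True)
        next
          case False
          then have "sym_diff ?J1 {i} = sym_diff B1 {x, i}" by auto
          then have "v (sym_diff ?J1 {i}) = 0" using no False i by (simp only:) blast
          then show ?thesis using False by (simp only: mult_zero_right mult_zero_left if_False)
        qed
      qed simp
      ultimately have "pos_sign ?D x * (v B1 * v B2) = 0"
        using x fin by simp
      then have "v B1 * v B2 = 0" by (metis mult_zero_right pos_sign_square_left)
      then show False using mult_eq_0_iff_mem pf_vectors_mem(2)[OF vP] B by blast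
    qed
    note exch = this
    show ?thesis unfolding orthogonal_matroid_def
    proof (intro conjI ballI)
      show "{J \<in> Pow {..<n}. v J \<noteq> 0} \<noteq> {}" using vP by (auto simp: pf_vectors_def)
      fix B1 B2 x
      assume B: "B1 \<in> {J \<in> Pow {..<n}. v J \<noteq> 0}" "B2 \<in> {J \<in> Pow {..<n}. v J \<noteq> 0}"
        and x: "x \<in> sym_diff B1 B2"
      then obtain y where y: "y \<in> sym_diff B1 B2" "y \<noteq> x" "v (sym_diff B1 {x, y}) \<noteq> 0"
        using exch[of B1 B2 x] by blast
      moreover have "sym_diff B1 {x, y} \<subseteq> {..<n}" using B x y(1) by auto
      ultimately show "\<exists>y\<in>sym_diff B1 B2. y \<noteq> x \<and> sym_diff B1 {x, y} \<in> {J \<in> Pow {..<n}. v J \<noteq> 0}"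
        by blast
    qed auto
  qed
  then show ?thesis using p wick unfolding weak_orthogonal_matroid_def by blast
qed

lemma weak_imp_pfaffian:
  assumes weak: "weak_orthogonal_matroid G n p"
  obtains A T v where "A \<in> carrier_mat n n" "T \<subseteq> {..<n}" "skew_symmetric_mat A"
    "elements_mat A \<subseteq> pf_elements G" "v \<in> p"
    "\<And>J. J \<subseteq> {..<n} \<Longrightarrow> v J = pfaffian (principal_submatrix A (sym_diff J T))"
proof -
  have p: "p \<in> proj_space G n" using weak by (simp add: weak_orthogonal_matroid_def)
  obtain u where u: "u \<in> p" using proj_space_nonempty[OF p] by blast
  have uP: "u \<in> pf_vectors G n" using p u by (rule proj_space_subset)
  \<comment> \<open>Any basis can serve as \<open>T\<close>; scaling by the inverse of
    \<open>u T\<close> makes its value 1.\<close>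
  then obtain T where T: "T \<subseteq> {..<n}" "u T \<noteq> 0" by (auto simp: pf_vectors_def)
  obtain h where h: "h \<in> G" "u T * h = 1"
    using pf_vectors_mem(2)[OF uP T] by (rule inverse_mem)
  define v where "v = restrict (\<lambda>J. h * u J) (Pow {..<n})"
  have v: "v \<in> p" unfolding v_def by (rule proj_space_scale[OF p u h(1)])
  have vP: "v \<in> pf_vectors G n" using p v by (rule proj_space_subset)
  have vT: "v T = 1" using T h by (simp add: v_def mult.commute)
  \<comment> \<open>The twist moves the basis \<open>T\<close> to the empty set, where a Pfaffian
    takes the value 1.\<close>
  define w where "w J = v (sym_diff J T)" for J
  have subT: "sym_diff J T \<subseteq> {..<n}" if "J \<subseteq> {..<n}" for J using that T by auto
  \<comment> \<open>A Pfaffian of size 2 is its upper entry, so the values of \<open>w\<close> on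
    pairs force the matrix.\<close>
  define a where "a i j = (if i < n \<and> j < n then
      (if i < j then w {i, j} else if j < i then - w {i, j} else 0) else 0)" for i j
  define A where "A = mat n n (\<lambda>(i, j). a i j)"
  have alt: "alternating_form a"
    by unfold_locales (auto simp: a_def insert_commute)
  have four_term: "wick_equation v J1 J2"
    if "J1 \<subseteq> {..<n}" "J2 \<subseteq> {..<n}" "card (sym_diff J1 J2) = 4" for J1 J2
    using weak v that unfolding weak_orthogonal_matroid_def by blast
  have w_mem: "w J \<in> pf_elements G" if "J \<subseteq> {..<n}" for J
    unfolding w_def using pf_vectors_mem(1)[OF vP subT[OF that]] .
  have wP: "w J = set_pfaffian a J" if "J \<subseteq> {..<n}" for J
  proof (rule four_term_wick_determines_pfaffian[OF alt _ _ _ _ _ _ that])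
    show "w {} = 1" using vT by (simp add: w_def)
    show "w {i, j} = a i j" if "i \<in> {..<n}" "j \<in> {..<n}" "i < j" for i j
      using that by (simp add: a_def)
    show "w J dvd 1" if "J \<subseteq> {..<n}" "w J \<noteq> 0" for J
      using that pf_vectors_mem(2)[OF vP subT] units unfolding w_def by blast
    show "wick_equation w J1 J2"
      if J: "J1 \<subseteq> {..<n}" "J2 \<subseteq> {..<n}" and "card (sym_diff J1 J2) = 4" for J1 J2
    proof -
      have "sym_diff (sym_diff J1 T) (sym_diff J2 T) = sym_diff J1 J2" by auto
      then have "wick_equation v (sym_diff J1 T) (sym_diff J2 T)"
        using four_term[OF subT[OF J(1)] subT[OF J(2)]] that(3) by simp
      then show ?thesis unfolding w_def wick_equation_twist .
    qed
    show "\<exists>y\<in>J. y \<noteq> x \<and> w (J - {x, y}) \<noteq> 0" if J: "J \<subseteq> {..<n}" "w J \<noteq> 0" "x \<in> J" for J x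
    proof -
      have D: "sym_diff (sym_diff J T) T = J" by auto
      have "orthogonal_matroid {..<n} {J \<in> Pow {..<n}. v J \<noteq> 0}"
        using weak v by (simp add: weak_orthogonal_matroid_def)
      moreover have "sym_diff J T \<in> {J \<in> Pow {..<n}. v J \<noteq> 0}"
        using J(2) subT[OF J(1)] by (simp add: w_def)
      moreover have "T \<in> {J \<in> Pow {..<n}. v J \<noteq> 0}"
        using T vT mult_eq_0_iff_mem[OF h(1)] by (simp add: v_def)
      ultimately obtain y where y: "y \<in> J" "y \<noteq> x" "v (sym_diff (sym_diff J T) {x, y}) \<noteq> 0"
        using orthogonal_matroidD[of "{..<n}" _ "sym_diff J T" T x] J(3) unfolding D by blast
      moreover have "sym_diff (sym_diff J T) {x, y} = sym_diff (J - {x, y}) T"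
        using y(1) J(3) by auto
      ultimately show ?thesis unfolding w_def by metis
    qed
  qed simp
  show ?thesis
  proof (rule that[of A T v])
    show "A \<in> carrier_mat n n" by (simp add: A_def)
    show "skew_symmetric_mat A"
    proof -
      have "transpose_mat A = - A"
        by (rule eq_matI) (simp_all add: A_def a_def insert_commute)
      then show ?thesis by (simp add: skew_symmetric_mat_def A_def alternating_form.diag[OF alt])
    qed
    show "elements_mat A \<subseteq> pf_elements G"
    proof
      fix z assume "z \<in> elements_mat A"
      then obtain i j where "i < n" "j < n" "z = a i j"
        by (auto simp: elements_mat_def A_def)
      \<comment> \<open>The entries below the diagonal are elements of the partial field because
        \<open>G\<close> contains -1.\<close>
      then show "z \<in> pf_elements G"
        using w_mem[of "{i, j}"] pf_elements_uminus by (auto simp: a_def pf_elements_def)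
    qed
    show "v J = pfaffian (principal_submatrix A (sym_diff J T))" if J: "J \<subseteq> {..<n}" for J
    proof -
      have "sym_diff (sym_diff J T) T = J" by auto
      then have "v J = w (sym_diff J T)" by (simp only: w_def)
      also have "\<dots> = set_pfaffian a (sym_diff J T)" using wP subT[OF J] .
      also have "\<dots> = set_pfaffian (\<lambda>i j. A $$ (i, j)) (sym_diff J T)"
      proof (rule set_pfaffian_cong)
        fix i j assume "i \<in> sym_diff J T" "j \<in> sym_diff J T"
        then have "i < n" "j < n" using subT[OF J] by blast+
        then show "a i j = A $$ (i, j)" by (simp add: A_def)
      qed
      also have "\<dots> = pfaffian (principal_submatrix A (sym_diff J T))"
        using pfaffian_principal_submatrix[OF _ subT[OF J], of A] by (simp add: A_def)
      finally show ?thesis .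
    qed
  qed (use T v in auto)
qed

end

theorem theorem4p3:
  fixes G :: "'a::comm_ring_1 set" and n :: nat and p :: "(nat set \<Rightarrow> 'a) set"
  assumes "partial_field G" and "p \<in> proj_space G n"
  shows "((\<exists>A\<in>carrier_mat n n. \<exists>T\<in>Pow {..<n}.
             skew_symmetric_mat A \<and> elements_mat A \<subseteq> pf_elements G \<and>
             (\<exists>v\<in>p. \<forall>J\<in>Pow {..<n}.
                v J = pfaffian (principal_submatrix A (sym_diff J T))))
          \<longleftrightarrow> strong_orthogonal_matroid G n p)
       \<and> (strong_orthogonal_matroid G n p \<longleftrightarrow> weak_orthogonal_matroid G n p)"
    (is "(?rep \<longleftrightarrow> ?strong) \<and> (_ \<longleftrightarrow> ?weak)")
proof -
  interpret partial_field G by fact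
  have "?rep \<Longrightarrow> ?strong" using pfaffian_imp_strong[OF assms(2)] by blast
  moreover have "?strong \<Longrightarrow> ?weak" by (rule strong_imp_weak)
  moreover have "?weak \<Longrightarrow> ?rep"
    by (erule weak_imp_pfaffian) (blast intro: Pow_iff[THEN iffD2])
  ultimately show ?thesis by blast
qed

end
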